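(* $$\pi^2\, m\big((1+w)(1+x)+(1-w)(1-x)y\big)=7\,\zeta(3),$$ where the polynomial is in the three variables $w,x,y$.
   Context: The (logarithmic) Mahler measure of a nonzero polynomial $P\in\mathbb{C}[x_1,\dots,x_n]$ is $m(P)=\frac{1}{(2\pi i)^n}\int_{\mathbb{T}^n}\log|P(x_1,\dots,x_n)|\,\frac{dx_1}{x_1}\cdots\frac{dx_n}{x_n}$, with $\mathbb{T}^n=\{|x_1|=\dots=|x_n|=1\}$. $\zeta$ is the Riemann zeta function. *)

theory Defs
  imports "HOL-Complex_Analysis.Complex_Analysis" "HOL-Library.Poly_Mapping"
begin

(* A polynomial maps each monomial (finitely supported exponent vector) to its coefficient.
   The variables are indexed by nat; a polynomial in n variables uses the indices 0, ..., n - 1.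
   The ring structure is the one of Poly_Mapping. *)

type_synonym 'a mpoly = "(nat \<Rightarrow>\<^sub>0 nat) \<Rightarrow>\<^sub>0 'a"

definition mvar :: "nat \<Rightarrow> 'a::comm_ring_1 mpoly" where
  "mvar i = Poly_Mapping.single (Poly_Mapping.single i 1) 1"

definition meval_monom :: "(nat \<Rightarrow> 'a::comm_ring_1) \<Rightarrow> (nat \<Rightarrow>\<^sub>0 nat) \<Rightarrow> 'a" where
  "meval_monom x a = (\<Prod>i\<in>Poly_Mapping.keys a. x i ^ Poly_Mapping.lookup a i)"

definition meval :: "'a::comm_ring_1 mpoly \<Rightarrow> (nat \<Rightarrow> 'a) \<Rightarrow> 'a" where
  "meval P x = (\<Sum>a\<in>Poly_Mapping.keys P. Poly_Mapping.lookup P a * meval_monom x a)"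

(* The integral over the torus of F(x) dx_1 ... dx_n, as a complex differential form: each
   coordinate runs once counterclockwise through the unit circle, parametrised on [0,1] as in
   contour_integral, and the pullback is integrated over the unit cube.
   As everywhere in the library, a non-integrable integrand gives the value 0. *)

definition torus_integral :: "nat \<Rightarrow> ((nat \<Rightarrow> complex) \<Rightarrow> complex) \<Rightarrow> complex" where
  "torus_integral n F =
     (LINT t : ({..<n} \<rightarrow>\<^sub>E {0..1}) | (\<Pi>\<^sub>M j\<in>{..<n}. lborel).
        F (\<lambda>j. circlepath 0 1 (t j)) *
        (\<Prod>j<n. vector_derivative (circlepath 0 1) (at (t j))))"

(* Meaningful for nonzero P in the variables 0, ..., n - 1. The convention ln 0 = 0 only
   concerns the zeros of P on the torus, a null set. The value is typed complex because the
   defining formula is a complex integral; it is always real, see mahler_measure_eq below. *)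

definition mahler_measure :: "nat \<Rightarrow> complex mpoly \<Rightarrow> complex" where
  "mahler_measure n P =
     1 / (2 * of_real pi * \<i>) ^ n *
     torus_integral n (\<lambda>x. of_real (ln (norm (meval P x))) * (\<Prod>j<n. 1 / x j))"

(* The Dirichlet series, which defines zeta on the half-plane Re s > 1 only. *)

definition riemann_zeta :: "complex \<Rightarrow> complex" where
  "riemann_zeta s = suminf (\<lambda>n. 1 / of_nat (Suc n) powr s)"

lemma meval_superset:
  assumes "finite S" "Poly_Mapping.keys P \<subseteq> S"
  shows "meval P x = (\<Sum>a\<in>S. Poly_Mapping.lookup P a * meval_monom x a)"
  unfolding meval_def using assms
  by (intro sum.mono_neutral_left) (auto simp: in_keys_iff)

lemma meval_monom_superset:
  assumes "finite S" "Poly_Mapping.keys a \<subseteq> S"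
  shows "meval_monom x a = (\<Prod>i\<in>S. x i ^ Poly_Mapping.lookup a i)"
  unfolding meval_monom_def using assms
  by (intro prod.mono_neutral_left) (auto simp: in_keys_iff)

lemma meval_monom_add: "meval_monom x (a + b) = meval_monom x a * meval_monom x b"
proof -
  let ?S = "Poly_Mapping.keys a \<union> Poly_Mapping.keys b"
  have "meval_monom x (a + b) = (\<Prod>i\<in>?S. x i ^ Poly_Mapping.lookup (a + b) i)"
    by (intro meval_monom_superset) (auto simp: Poly_Mapping.keys_add)
  also have "\<dots> = (\<Prod>i\<in>?S. x i ^ Poly_Mapping.lookup a i) * (\<Prod>i\<in>?S. x i ^ Poly_Mapping.lookup b i)"
    by (simp add: lookup_add power_add prod.distrib)
  also have "\<dots> = meval_monom x a * meval_monom x b"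
    by (simp add: meval_monom_superset[of ?S])
  finally show ?thesis .
qed

lemma meval_zero [simp]: "meval 0 x = 0"
  by (simp add: meval_def)

lemma meval_one [simp]: "meval 1 x = 1"
  by (simp add: meval_def meval_monom_def)

lemma meval_single: "meval (Poly_Mapping.single a c) x = c * meval_monom x a"
  by (simp add: meval_def)

lemma meval_var [simp]: "meval (mvar i) x = x i"
  by (simp add: mvar_def meval_single meval_monom_def)

lemma meval_add [simp]: "meval (P + Q) x = meval P x + meval Q x"
proof -
  let ?S = "Poly_Mapping.keys P \<union> Poly_Mapping.keys Q"
  have "meval (P + Q) x = (\<Sum>a\<in>?S. Poly_Mapping.lookup (P + Q) a * meval_monom x a)"
    by (intro meval_superset) (auto simp: Poly_Mapping.keys_add)
  then show ?thesis
    by (simp add: lookup_add distrib_right sum.distrib meval_superset[of ?S])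
qed

lemma meval_uminus [simp]: "meval (- P) x = - meval P x"
  by (metis add.right_inverse add_eq_0_iff meval_add meval_zero)

lemma meval_diff [simp]: "meval (P - Q) x = meval P x - meval Q x"
  by (metis diff_add_cancel add_diff_cancel meval_add)

lemma mpoly_update_eq:
  fixes f :: "'a::comm_ring_1 mpoly"
  assumes "a \<notin> Poly_Mapping.keys f"
  shows "Poly_Mapping.update a b f = Poly_Mapping.single a b + f"
  using assms
  by (intro poly_mapping_eqI) (auto simp: lookup_update lookup_add lookup_single in_keys_iff when_def)

lemma meval_single_mult:
  "meval (Poly_Mapping.single a c * Q) x = meval (Poly_Mapping.single a c) x * meval Q x"
  by (induction Q rule: update_induct)
     (simp_all add: mpoly_update_eq distrib_left mult_single meval_single meval_monom_add
        mult_ac)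

lemma meval_mult [simp]: "meval (P * Q) x = meval P x * meval Q x"
  by (induction P rule: update_induct)
     (simp_all add: mpoly_update_eq distrib_right meval_single_mult)

lemma mahler_measure_eq:
  "mahler_measure n P =
     of_real (LINT t : ({..<n} \<rightarrow>\<^sub>E {0..1}) | (\<Pi>\<^sub>M j\<in>{..<n}. lborel).
        ln (norm (meval P (\<lambda>j. exp (2 * of_real pi * \<i> * of_real (t j))))))"
proof -
  have c: "circlepath 0 1 t = exp (2 * of_real pi * \<i> * of_real t)" for t
    by (simp add: circlepath)
  have d: "vector_derivative (circlepath 0 1) (at t) =
      2 * of_real pi * \<i> * exp (2 * of_real pi * \<i> * of_real t)" for t
    by (simp add: vector_derivative_circlepath)
  have "(\<Prod>j<n. 1 / exp (2 * of_real pi * \<i> * of_real (t j))) *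
      (\<Prod>j<n. 2 * of_real pi * \<i> * exp (2 * of_real pi * \<i> * of_real (t j))) =
      (2 * of_real pi * \<i>) ^ n" for t :: "nat \<Rightarrow> real"
    by (simp flip: prod.distrib)
  then have "torus_integral n (\<lambda>x. of_real (ln (norm (meval P x))) * (\<Prod>j<n. 1 / x j)) =
     (LINT t : ({..<n} \<rightarrow>\<^sub>E {0..1}) | (\<Pi>\<^sub>M j\<in>{..<n}. lborel).
        of_real (ln (norm (meval P (\<lambda>j. exp (2 * of_real pi * \<i> * of_real (t j)))))) *
        (2 * of_real pi * \<i>) ^ n)"
    unfolding torus_integral_def c d by (simp only: mult.assoc)
  then show ?thesis
    by (simp add: mahler_measure_def set_integral_complex_of_real del: of_real_power)
qed

end

theory Submission
  imports Defs "HOL-Real_Asymp.Real_Asymp"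
begin

text \<open>
  Write the polynomial as \<open>a + b * y\<close> with \<open>a = (1 + w) * (1 + x)\<close> and
  \<open>b = (1 - w) * (1 - x)\<close>. Jensen's formula (\<open>jensen_linear\<close>) integrates \<open>y\<close> out and leaves
  the mean of \<open>ln (max (norm a) (norm b))\<close>, which is
  \<open>ln (norm (1 + w)) + ln (norm (1 + x))\<close> plus the positive part of \<open>ln (norm b / norm a)\<close>.
  The first two terms have mean 0, again by Jensen's formula, and for \<open>w = cis (2 * pi * s)\<close>,
  \<open>x = cis (2 * pi * t)\<close> the quotient \<open>norm b / norm a\<close> is
  \<open>\<bar>tan (pi * s)\<bar> * \<bar>tan (pi * t)\<bar>\<close>.

  For uniform \<open>s\<close>, the number \<open>\<bar>tan (pi * s)\<bar>\<close> has the half-Cauchy density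
  \<open>2 / pi * 1 / (1 + u\<^sup>2)\<close> (\<open>nn_integral_abs_tan\<close>), and a product of two independent such variables
  has density \<open>(2 / pi)\<^sup>2 * ln p / (p\<^sup>2 - 1)\<close> (\<open>nn_integral_product_half_cauchy\<close>). Hence the Mahler
  measure is \<open>4 / pi\<^sup>2\<close> times the integral of \<open>(ln p)\<^sup>2 / (p\<^sup>2 - 1)\<close> over \<open>p > 1\<close>. Expanding
  \<open>1 / (p\<^sup>2 - 1)\<close> as a geometric series in \<open>1 / p\<^sup>2\<close> turns this integral into twice the sum of the
  inverse cubes of the odd numbers (\<open>nn_integral_ln_sq\<close>), that is \<open>7 / 4\<close> times \<open>\<zeta>(3)\<close>.

  The logarithm is unbounded below on the torus. All iterated integrals are therefore taken of
  the nonnegative function \<open>ln 8 - ln (norm P)\<close>, as extended nonnegative integrals: Tonelli's theorem then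
  applies freely, and the integrability of \<open>ln (norm P)\<close> comes out at the end, since the
  result is finite (\<open>nn_integral_log_polynomial\<close>).
\<close>

section \<open>Jensen's formula for linear polynomials\<close>

lemma borel_measurable_cis [measurable]: "cis \<in> borel_measurable borel"
  by (intro borel_measurable_continuous_onI continuous_intros)

text \<open>The mean value property of the harmonic function \<open>Re (Ln (1 + z * w))\<close>, which lives on a
  neighbourhood of the closed unit disc in \<open>w\<close> and vanishes at its centre.\<close>
lemma jensen_disc:
  assumes "norm z < 1"
  shows "has_bochner_integral lborel
           (\<lambda>t. indicator {0..1} t * ln (norm (1 + z * cis (2 * pi * t)))) 0"
proof -
  have zw: "norm (z * w) < 1" if "norm w \<le> 1" for w
  proof -
    have "norm z * norm w \<le> norm z * 1" by (intro mult_left_mono that) auto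
    thus ?thesis using assms by (simp add: norm_mult)
  qed
  have Re_pos: "Re (1 + z * w) > 0" if "norm w \<le> 1" for w
    using zw[OF that] abs_Re_le_cmod[of "z * w"] by (simp add: abs_le_iff)
  have not_neg: "1 + z * w \<notin> \<real>\<^sub>\<le>\<^sub>0" if "norm w \<le> 1" for w
    using Re_pos[OF that] by (auto simp: complex_nonpos_Reals_iff)
  have nz: "1 + z * cis t \<noteq> 0" for t
    using Re_pos[of "cis t"] by (metis norm_cis order_refl less_irrefl zero_complex.sel(1))
  have circle: "circlepath 0 1 t = cis (2 * pi * t)" for t
    by (simp add: circlepath cis_conv_exp mult_ac)
  have circle': "vector_derivative (circlepath 0 1) (at t) = 2 * of_real pi * \<i> * cis (2 * pi * t)" for t
    by (simp add: vector_derivative_circlepath cis_conv_exp mult_ac)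
  have "(\<lambda>w. Ln (1 + z * w)) holomorphic_on cball 0 1"
    using not_neg by (intro holomorphic_intros) auto
  then have "((\<lambda>w. Ln (1 + z * w) / w) has_contour_integral 0) (circlepath 0 1)"
    using Cauchy_integral_circlepath_simple[of "\<lambda>w. Ln (1 + z * w)" 0 1 0] by simp
  then have "((\<lambda>t. 2 * of_real pi * \<i> * Ln (1 + z * cis (2 * pi * t))) has_integral 0) {0..1}"
    unfolding has_contour_integral
    by (simp add: circle circle' mult_ac)
  \<comment> \<open>The factor \<open>\<i>\<close> moves the real part of \<open>Ln\<close>, the logarithm of the norm, to the imaginary part.\<close>
  from has_integral_linear[OF this bounded_linear_Im]
  have "((\<lambda>t. (2 * pi) * ln (norm (1 + z * cis (2 * pi * t)))) has_integral 0) {0..1}"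
    by (simp add: o_def nz)
  from has_integral_mult_right[OF this, of "1 / (2 * pi)"]
  have "((\<lambda>t. ln (norm (1 + z * cis (2 * pi * t)))) has_integral 0) {0..1}"
    by simp
  then have I: "((\<lambda>t. indicator {0..1} t * ln (norm (1 + z * cis (2 * pi * t)))) has_integral 0) UNIV"
    by (subst (asm) has_integral_restrict_UNIV[symmetric])
       (simp add: indicator_def of_bool_def if_distrib[of "\<lambda>x. x * _"] cong: if_cong)
  have int: "integrable lborel (\<lambda>t. indicator {0..1} t *\<^sub>R ln (norm (1 + z * cis (2 * pi * t))))"
    using nz by (intro borel_integrable_compact continuous_intros) auto
  from has_integral_unique[OF I] has_integral_integral_real[OF int] int show ?thesis
    by (auto simp: has_bochner_integral_iff)
qed

text \<open>After squaring and clearing denominators, the difference of the two sides is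
  \<open>2 * (1 - Re z) * (s - r) * (1 - r * s)\<close>. The normalisation by \<open>1 + r\<close> is what makes the norm
  monotone in \<open>r\<close>; it allows monotone convergence in the boundary case of Jensen's formula.\<close>
lemma norm_one_plus_scaled_mono:
  fixes z :: complex and r s :: real
  assumes "norm z = 1" "0 \<le> r" "r \<le> s" "s \<le> 1"
  shows "norm (1 + of_real s * z) / (1 + s) \<le> norm (1 + of_real r * z) / (1 + r)"
proof -
  have xy: "Re z ^ 2 + Im z ^ 2 = 1" using assms(1) by (simp add: cmod_def)
  have sq: "norm (1 + of_real t * z) ^ 2 = 1 + 2 * t * Re z + t ^ 2" for t
  proof -
    have "norm (1 + of_real t * z) ^ 2 = 1 + 2 * t * Re z + t ^ 2 * (Re z ^ 2 + Im z ^ 2)"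
      by (simp only: cmod_power2) (simp add: power2_eq_square algebra_simps)
    thus ?thesis by (simp add: xy)
  qed
  have "Re z \<le> 1" using complex_Re_le_cmod[of z] assms by simp
  moreover have "r * s \<le> 1" using mult_mono[of r 1 s 1] assms by simp
  ultimately have "0 \<le> 2 * (1 - Re z) * (s - r) * (1 - r * s)"
    using assms by (intro mult_nonneg_nonneg) auto
  then have "(1 + 2 * s * Re z + s ^ 2) * (1 + r) ^ 2 \<le> (1 + 2 * r * Re z + r ^ 2) * (1 + s) ^ 2"
    by (simp add: power2_eq_square algebra_simps)
  then have "(norm (1 + of_real s * z) * (1 + r)) ^ 2 \<le> (norm (1 + of_real r * z) * (1 + s)) ^ 2"
    by (simp only: power_mult_distrib sq)
  then have "norm (1 + of_real s * z) * (1 + r) \<le> norm (1 + of_real r * z) * (1 + s)"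
    using assms by (intro power2_le_imp_le[of "_ * _"]) auto
  then show ?thesis using assms by (simp add: field_simps)
qed

text \<open>The exceptional parameters form at most one coset of the integers. Used to discard the zeros of
  the logarithms, where the convention \<open>ln 0 = 0\<close> breaks the functional equation of \<open>ln\<close>.\<close>
lemma AE_cis_neq: "AE t in lborel. cis (2 * pi * t) \<noteq> w"
proof (cases "\<exists>t0. cis (2 * pi * t0) = w")
  case True
  then obtain t0 where t0: "cis (2 * pi * t0) = w" by blast
  have "{t. cis (2 * pi * t) = w} \<subseteq> range (\<lambda>n::int. t0 + of_int n)"
  proof
    fix t assume "t \<in> {t. cis (2 * pi * t) = w}"
    then have "exp (\<i> * of_real (2 * pi * t)) = exp (\<i> * of_real (2 * pi * t0))"
      using t0 by (simp add: cis_conv_exp)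
    then obtain n :: int where "\<i> * of_real (2 * pi * t) = \<i> * of_real (2 * pi * t0) + (of_int (2 * n) * pi) * \<i>"
      unfolding exp_eq by blast
    from arg_cong[OF this, of Im] have "2 * pi * t = 2 * pi * (t0 + of_int n)"
      by (simp add: algebra_simps)
    then show "t \<in> range (\<lambda>n::int. t0 + of_int n)" by auto
  qed
  then have "countable {t. cis (2 * pi * t) = w}"
    by (rule countable_subset) auto
  from AE_not_in[OF countable_imp_null_set_lborel[OF this]] show ?thesis by simp
qed auto

text \<open>The limit \<open>r \<longlongrightarrow> 1\<close> of \<open>jensen_disc\<close> for \<open>r * z\<close>. Monotone convergence yields
  integrability of the limit together with its integral, so that the logarithmic singularity
  needs no separate estimate.\<close>
lemma jensen_circle:
  assumes "norm z = 1"
  shows "has_bochner_integral lborel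
           (\<lambda>t. indicator {0..1} t * ln (norm (1 + z * cis (2 * pi * t)))) 0"
proof -
  define r where "r n = 1 - 1 / real (n + 2)" for n
  have r: "0 \<le> r n" "r n < 1" for n by (auto simp: r_def)
  have r_mono: "r m \<le> r n" if "m \<le> n" for m n
    using that by (auto simp: r_def field_simps)
  have r_lim: "r \<longlonglongrightarrow> 1" unfolding r_def by real_asymp
  have nz: "1 + of_real (r n) * (z * cis t) \<noteq> 0" for n t
  proof
    assume "1 + of_real (r n) * (z * cis t) = 0"
    then have "norm (of_real (r n) * (z * cis t)) = norm (-1 :: complex)"
      by (simp add: add_eq_0_iff)
    then show False using r[of n] assms by (simp add: norm_mult)
  qed
  have nz1: "1 + z * w \<noteq> 0" if "w \<noteq> - 1 / z" for w
  proof
    assume "1 + z * w = 0"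
    then have "z * w = -1" by (simp add: add_eq_0_iff)
    moreover have "z \<noteq> 0" using assms by auto
    ultimately show False using that by (simp add: field_simps)
  qed
  let ?f = "\<lambda>n t. - (indicator {0..1} t * ln (norm (1 + of_real (r n) * (z * cis (2 * pi * t))) / (1 + r n)))"
  have split: "?f n t = indicator {0..1} t * ln (1 + r n) - 
      indicator {0..1} t * ln (norm (1 + (of_real (r n) * z) * cis (2 * pi * t)))" for n t
    using r[of n] nz[of n "2 * pi * t"] 
      by (subst ln_div) (auto simp: right_diff_distrib mult.assoc)
  have hb: "has_bochner_integral lborel (?f n) (ln (1 + r n))" for n
  proof -
    have "norm (of_real (r n) * z) < 1" using r[of n] assms by (simp add: norm_mult)
    from jensen_disc[OF this]
    have "has_bochner_integral lborel (?f n) (ln (1 + r n) - 0)"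
      unfolding split by (intro has_bochner_integral_diff)
        (auto simp: has_bochner_integral_iff)
    then show ?thesis by simp
  qed
  have "has_bochner_integral lborel 
      (\<lambda>t. - (indicator {0..1} t * ln (norm (1 + z * cis (2 * pi * t)) / 2))) (ln 2)"
  proof (rule has_bochner_integral_monotone_convergence)
    show "integrable lborel (?f n)" for n using hb by (simp add: has_bochner_integral_iff)
    show "AE t in lborel. mono (\<lambda>n. ?f n t)"
    proof (intro AE_I2 monoI)
      fix t and m n :: nat assume "m \<le> n"
      have "norm (1 + of_real (r n) * (z * cis (2 * pi * t))) / (1 + r n) 
         \<le> norm (1 + of_real (r m) * (z * cis (2 * pi * t))) / (1 + r m)"
        using r_mono[OF \<open>m \<le> n\<close>] r[of m] r[of n] assms
        by (intro norm_one_plus_scaled_mono) (auto simp: norm_mult)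
      moreover have "norm (1 + of_real (r n) * (z * cis (2 * pi * t))) / (1 + r n) > 0"
        using nz[of n] r[of n] by (auto intro!: divide_pos_pos)
      ultimately show "?f m t \<le> ?f n t"
        by (simp add: indicator_def)
    qed
    show "AE t in lborel. (\<lambda>n. ?f n t) \<longlonglongrightarrow> 
       - (indicator {0..1} t * ln (norm (1 + z * cis (2 * pi * t)) / 2))"
      using AE_cis_neq[of "- 1 / z"]
    proof eventually_elim
      case (elim t)
      have "1 + z * cis (2 * pi * t) \<noteq> 0"
        by (rule nz1[OF elim])
      then have "1 + of_real 1 * (z * cis (2 * pi * t)) \<noteq> 0" by simp
      then have "(\<lambda>n. ?f n t) \<longlonglongrightarrow> 
       - (indicator {0..1} t * ln (norm (1 + of_real 1 * (z * cis (2 * pi * t))) / (1 + 1)))"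
        by (intro tendsto_intros r_lim) auto
      then show ?case by simp
    qed
    have "(\<lambda>n. ln (1 + r n)) \<longlonglongrightarrow> ln (1 + 1)"
      by (intro tendsto_intros r_lim) auto
    then show "(\<lambda>n. integral\<^sup>L lborel (?f n)) \<longlonglongrightarrow> ln 2"
      by (simp only: has_bochner_integral_integral_eq[OF hb] one_add_one)
  qed measurable
  then have "has_bochner_integral lborel 
      (\<lambda>t. indicator {0..1} t * ln 2 -
         (- (indicator {0..1} t * ln (norm (1 + z * cis (2 * pi * t)) / 2)))) (ln 2 - ln 2)"
    by (intro has_bochner_integral_diff) (auto simp: has_bochner_integral_iff)
  moreover have "AE t in lborel. indicator {0..1} t * ln 2 -
         (- (indicator {0..1} t * ln (norm (1 + z * cis (2 * pi * t)) / 2))) =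
         indicator {0..1} t * ln (norm (1 + z * cis (2 * pi * t)))"
    using AE_cis_neq[of "- 1 / z"]
  proof eventually_elim
    case (elim t)
    have "1 + z * cis (2 * pi * t) \<noteq> 0"
      by (rule nz1[OF elim])
    then show ?case by (simp add: ln_div algebra_simps)
  qed
  ultimately show ?thesis
    by (subst (asm) has_bochner_integral_cong_AE) auto
qed

text \<open>If \<open>norm b \<le> norm a\<close>, divide by \<open>a\<close>. Otherwise the coefficients can be exchanged, because
  \<open>norm (a + b * w) = norm (cnj b + cnj a * w)\<close> on the unit circle.\<close>
lemma jensen_linear:
  assumes "a \<noteq> 0 \<or> b \<noteq> 0"
  shows "has_bochner_integral lborel
           (\<lambda>t. indicator {0..1} t * ln (norm (a + b * cis (2 * pi * t)))) (ln (max (norm a) (norm b)))"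
proof -
  have *: "has_bochner_integral lborel
           (\<lambda>t. indicator {0..1} t * ln (norm (a + b * cis (2 * pi * t)))) (ln (norm a))"
    if ab: "norm b \<le> norm a" "a \<noteq> 0" for a b :: complex
  proof -
    have "norm (b / a) < 1 \<or> norm (b / a) = 1"
      using ab by (auto simp: norm_divide field_simps)
    then have "has_bochner_integral lborel
           (\<lambda>t. indicator {0..1} t * ln (norm (1 + (b / a) * cis (2 * pi * t)))) 0"
      using jensen_disc jensen_circle by blast
    then have "has_bochner_integral lborel (\<lambda>t. indicator {0..1} t * ln (norm a) + 
         indicator {0..1} t * ln (norm (1 + (b / a) * cis (2 * pi * t)))) (ln (norm a) + 0)"
      by (intro has_bochner_integral_add) (auto simp: has_bochner_integral_iff)
    moreover have "AE t in lborel. indicator {0..1} t * ln (norm a) + 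
         indicator {0..1} t * ln (norm (1 + (b / a) * cis (2 * pi * t))) =
         indicator {0..1} t * ln (norm (a + b * cis (2 * pi * t)))"
      using AE_cis_neq[of "- a / b"]
    proof eventually_elim
      case (elim t)
      have eq: "a + b * cis (2 * pi * t) = a * (1 + (b / a) * cis (2 * pi * t))"
        using ab by (simp add: field_simps)
      have "a + b * cis (2 * pi * t) \<noteq> 0"
        using elim ab by (cases "b = 0") (auto simp: field_simps add_eq_0_iff)
      then have "1 + (b / a) * cis (2 * pi * t) \<noteq> 0" unfolding eq by auto
      then show ?case unfolding eq norm_mult using ab 
        by (simp add: ln_mult algebra_simps)
    qed
    ultimately show ?thesis
      by (subst (asm) has_bochner_integral_cong_AE) auto
  qed
  show ?thesis
  proof (cases "norm b \<le> norm a")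
    case True
    with assms have "a \<noteq> 0" by auto
    with True show ?thesis using *[of b a] by (simp add: max_def)
  next
    case False
    have "norm (a + b * cis s) = norm (cnj b + cnj a * cis s)" for s
    proof -
      have "norm (a + b * cis s) = norm (cis s * cnj (a + b * cis s))"
        by (simp only: norm_mult complex_mod_cnj norm_cis mult_1)
      also have "cis s * cnj (a + b * cis s) = cnj b * (cis s * cnj (cis s)) + cnj a * cis s"
        by (simp add: algebra_simps del: cis_cnj)
      also have "cis s * cnj (cis s) = 1"
        by (simp add: cis_cnj cis_mult)
      finally show ?thesis by simp
    qed
    moreover from False have "b \<noteq> 0" by auto
    ultimately show ?thesis using *[of "cnj a" "cnj b"] False by (simp add: max_def)
  qed
qed

section \<open>The product of two half-Cauchy variables\<close>

text \<open>Monotone limit of the substitution rule on compact intervals. The image interval is open at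
  \<open>T\<close>, the limit of \<open>g\<close>, which is never attained.\<close>
lemma nn_integral_substitution_atLeast:
  fixes f :: "real \<Rightarrow> ennreal" and g g' :: "real \<Rightarrow> real"
  assumes [measurable]: "f \<in> borel_measurable borel"
    and deriv: "\<And>x. x \<ge> a \<Longrightarrow> (g has_real_derivative g' x) (at x)"
    and cont: "continuous_on {a..} g'"
    and nonneg: "\<And>x. x \<ge> a \<Longrightarrow> g' x \<ge> 0"
    and lim: "(g \<longlongrightarrow> T) at_top"
    and less: "\<And>x. x \<ge> a \<Longrightarrow> g x < T"
    and [measurable]: "(\<lambda>x. f (g x) * ennreal (g' x)) \<in> borel_measurable borel"
  shows "(\<integral>\<^sup>+y. f y * indicator {g a..<T} y \<partial>lborel) =
         (\<integral>\<^sup>+x. f (g x) * ennreal (g' x) * indicator {a..} x \<partial>lborel)"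
proof -
  define b where "b n = a + real (Suc n)" for n
  have b: "a < b n" "a \<le> b n" for n by (auto simp: b_def)
  have b_mono: "b m \<le> b n" if "m \<le> n" for m n using that by (simp add: b_def)
  have b_lim: "filterlim b at_top sequentially" unfolding b_def by real_asymp
  have g_mono: "g x \<le> g y" if "a \<le> x" "x \<le> y" for x y
    using deriv nonneg that by (intro DERIV_nonneg_imp_nondecreasing[of x y g]) (auto intro: order_trans)
  have eq: "(\<integral>\<^sup>+y. f y * indicator {g a..g (b n)} y \<partial>lborel) =
         (\<integral>\<^sup>+x. f (g x) * ennreal (g' x) * indicator {a..b n} x \<partial>lborel)" for n
    using b[of n] deriv nonneg by (intro nn_integral_substitution_aux continuous_on_subset[OF cont]) auto
  have "(\<lambda>n. \<integral>\<^sup>+y. f y * indicator {g a..g (b n)} y \<partial>lborel) \<longlonglongrightarrow>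
        (\<integral>\<^sup>+y. f y * indicator {g a..<T} y \<partial>lborel)"
  proof (rule nn_integral_LIMSEQ)
    show "incseq (\<lambda>n y. f y * indicator {g a..g (b n)} y)"
    proof (intro incseq_SucI le_funI mult_left_mono)
      fix n y
      have "g (b n) \<le> g (b (Suc n))" using g_mono b b_mono by simp
      then show "indicator {g a..g (b n)} y \<le> (indicator {g a..g (b (Suc n))} y :: ennreal)"
        by (auto simp: indicator_def)
    qed auto
    fix y
    show "(\<lambda>n. f y * indicator {g a..g (b n)} y) \<longlonglongrightarrow> f y * indicator {g a..<T} y"
    proof (rule tendsto_eventually, cases "y < T")
      case True
      have "eventually (\<lambda>n. y < g (b n)) sequentially"
        using order_tendstoD(1)[OF lim True] b_lim by (rule eventually_compose_filterlim)
      then show "eventually (\<lambda>n. f y * indicator {g a..g (b n)} y = f y * indicator {g a..<T} y) sequentially"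
        by eventually_elim (use True in \<open>auto simp: indicator_def\<close>)
    next
      case False
      then have "y > g (b n)" for n using less[OF b(2)[of n]] by linarith
      then show "eventually (\<lambda>n. f y * indicator {g a..g (b n)} y = f y * indicator {g a..<T} y) sequentially"
        using False by (intro always_eventually allI) (auto simp: indicator_def not_le)
    qed
  qed measurable
  moreover have "(\<lambda>n. \<integral>\<^sup>+x. f (g x) * ennreal (g' x) * indicator {a..b n} x \<partial>lborel) \<longlonglongrightarrow>
        (\<integral>\<^sup>+x. f (g x) * ennreal (g' x) * indicator {a..} x \<partial>lborel)"
  proof (rule nn_integral_LIMSEQ)
    show "incseq (\<lambda>n x. f (g x) * ennreal (g' x) * indicator {a..b n} x)"
      using b_mono
      by (auto intro!: incseq_SucI le_funI mult_left_mono simp: indicator_def b_def)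
    fix x
    have "eventually (\<lambda>n. x \<le> b n) sequentially"
      using b_lim by (simp add: filterlim_at_top)
    then show "(\<lambda>n. f (g x) * ennreal (g' x) * indicator {a..b n} x) \<longlonglongrightarrow>
        f (g x) * ennreal (g' x) * indicator {a..} x"
      by (intro tendsto_eventually, elim eventually_mono) (auto simp: indicator_def)
  qed measurable
  ultimately show ?thesis unfolding eq by (rule LIMSEQ_unique)
qed

lemma borel_measurable_tan [measurable]: "(tan :: real \<Rightarrow> real) \<in> borel_measurable borel"
  unfolding tan_def by measurable

text \<open>Substitution of \<open>t = arctan u / pi\<close> on the half \<open>t < 1/2\<close>; the reflection \<open>t \<mapsto> 1 - t\<close> gives
  the same contribution on the other half, hence the factor 2.\<close>
lemma nn_integral_abs_tan:
  assumes [measurable]: "G \<in> borel_measurable borel"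
  shows "(\<integral>\<^sup>+t. G \<bar>tan (pi * t)\<bar> * indicator {0..1} t \<partial>lborel) =
         ennreal (2 / pi) * (\<integral>\<^sup>+u. G u * ennreal (1 / (1 + u\<^sup>2)) * indicator {0..} u \<partial>lborel)"
    (is "?I = _ * ?J")
proof -
  let ?H = "\<integral>\<^sup>+t. G \<bar>tan (pi * t)\<bar> * indicator {0..<1/2} t \<partial>lborel"
  have "((\<lambda>u. arctan u / pi) \<longlongrightarrow> (pi / 2) / pi) at_top"
    by (intro tendsto_intros tendsto_arctan_at_top) auto
  then have lim: "((\<lambda>u. arctan u / pi) \<longlongrightarrow> 1/2) at_top" by simp
  have "(\<integral>\<^sup>+t. G \<bar>tan (pi * t)\<bar> * indicator {arctan 0 / pi..<1/2} t \<partial>lborel) =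
    (\<integral>\<^sup>+u. G \<bar>tan (pi * (arctan u / pi))\<bar> * ennreal (1 / (1 + u\<^sup>2) / pi) * indicator {0..} u \<partial>lborel)"
    using lim arctan_ubound
    by (intro nn_integral_substitution_atLeast)
       (auto intro!: derivative_eq_intros continuous_intros 
         simp: field_simps power2_eq_square sum_squares_eq_zero_iff add_nonneg_eq_0_iff)
  also have "\<dots> = (\<integral>\<^sup>+u. ennreal (1 / pi) * (G u * ennreal (1 / (1 + u\<^sup>2)) * indicator {0..} u) \<partial>lborel)"
  proof (intro nn_integral_cong)
    fix u :: real
    have "ennreal (1 / (1 + u\<^sup>2) / pi) = ennreal (1 / pi) * ennreal (1 / (1 + u\<^sup>2))"
      by (subst ennreal_mult[symmetric]) auto
    then show "G \<bar>tan (pi * (arctan u / pi))\<bar> * ennreal (1 / (1 + u\<^sup>2) / pi) * indicator {0..} u =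
        ennreal (1 / pi) * (G u * ennreal (1 / (1 + u\<^sup>2)) * indicator {0..} u)"
      by (auto simp: tan_arctan indicator_def mult_ac)
  qed
  also have "\<dots> = ennreal (1 / pi) * ?J"
    by (rule nn_integral_cmult) measurable
  finally have H: "?H = ennreal (1 / pi) * ?J" by simp
  have "(\<integral>\<^sup>+t. G \<bar>tan (pi * t)\<bar> * indicator {1/2<..1} t \<partial>lborel) =
        (\<integral>\<^sup>+t. G \<bar>tan (pi * (1 + (-1) * t))\<bar> * indicator {1/2<..1} (1 + (-1) * t) \<partial>lborel)"
    by (subst nn_integral_real_affine[of _ "-1" 1]) auto
  also have "\<dots> = ?H"
  proof (intro nn_integral_cong)
    fix t :: real
    have "tan (pi * (1 + (-1) * t)) = - tan (pi * t)"
      using tan_periodic_pi[of "- (pi * t)"] by (simp add: algebra_simps)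
    then show "G \<bar>tan (pi * (1 + (-1) * t))\<bar> * indicator {1/2<..1} (1 + (-1) * t) =
        G \<bar>tan (pi * t)\<bar> * indicator {0..<1/2} t"
      by (auto simp: indicator_def)
  qed
  finally have H': "(\<integral>\<^sup>+t. G \<bar>tan (pi * t)\<bar> * indicator {1/2<..1} t \<partial>lborel) = ?H" .
  have "?I = (\<integral>\<^sup>+t. G \<bar>tan (pi * t)\<bar> * indicator {0..<1/2} t + 
                    G \<bar>tan (pi * t)\<bar> * indicator {1/2<..1} t \<partial>lborel)"
    using AE_lborel_singleton[of "1/2 :: real"]
    by (intro nn_integral_cong_AE, elim eventually_mono) (auto simp: indicator_def)
  also have "\<dots> = ?H + ?H"
    by (subst nn_integral_add) (auto simp: H')
  also have "\<dots> = (ennreal (1 / pi) + ennreal (1 / pi)) * ?J"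
    unfolding H by (rule distrib_right[symmetric])
  also have "ennreal (1 / pi) + ennreal (1 / pi) = ennreal (2 / pi)"
    by (simp flip: ennreal_plus)
  finally show ?thesis .
qed

text \<open>Partial fractions give the primitive
  \<open>(ln (1 + u\<^sup>2) - ln (u\<^sup>2 + p\<^sup>2)) / (2 * (p\<^sup>2 - 1))\<close>, which vanishes at infinity.\<close>
lemma nn_integral_half_cauchy_convolution:
  assumes p: "p > 0" "p \<noteq> (1 :: real)"
  shows "(\<integral>\<^sup>+u. ennreal (u / ((1 + u\<^sup>2) * (u\<^sup>2 + p\<^sup>2))) * indicator {0..} u \<partial>lborel) =
           ennreal (ln p / (p\<^sup>2 - 1))"
proof -
  have p2: "p\<^sup>2 \<noteq> 1" using p by (simp add: power2_eq_1_iff)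
  have pos: "u\<^sup>2 + p\<^sup>2 > 0" "1 + u\<^sup>2 > 0" for u :: real using p by (auto intro: add_nonneg_pos add_pos_nonneg)
  have nz: "u\<^sup>2 + p\<^sup>2 \<noteq> 0" "1 + u\<^sup>2 \<noteq> 0" for u :: real using pos[of u] by auto
  define F where "F u = (ln (1 + u\<^sup>2) - ln (u\<^sup>2 + p\<^sup>2)) / (2 * (p\<^sup>2 - 1))" for u
  have "(\<integral>\<^sup>+u. ennreal (u / ((1 + u\<^sup>2) * (u\<^sup>2 + p\<^sup>2))) * indicator {0..} u \<partial>lborel) = ennreal (0 - F 0)"
  proof (rule nn_integral_FTC_atLeast)
    show "DERIV F u :> u / ((1 + u\<^sup>2) * (u\<^sup>2 + p\<^sup>2))" for u
    proof -
      have "DERIV F u :> (2 * u / (1 + u\<^sup>2) - 2 * u / (u\<^sup>2 + p\<^sup>2)) / (2 * (p\<^sup>2 - 1))"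
        unfolding F_def using pos[of u] p2 by (auto intro!: derivative_eq_intros)
      also have "2 * u / (1 + u\<^sup>2) - 2 * u / (u\<^sup>2 + p\<^sup>2) = 
         (2 * (p\<^sup>2 - 1)) * (u / ((1 + u\<^sup>2) * (u\<^sup>2 + p\<^sup>2)))"
        using nz[of u] by (simp add: field_simps)
      also have "\<dots> / (2 * (p\<^sup>2 - 1)) = u / ((1 + u\<^sup>2) * (u\<^sup>2 + p\<^sup>2))" using p2 by simp
      finally show ?thesis .
    qed
    show "(F \<longlongrightarrow> 0) at_top"
    proof -
      have "((\<lambda>u. ln (1 + u\<^sup>2) - ln (u\<^sup>2 + p\<^sup>2)) \<longlongrightarrow> 0) at_top" using p by real_asymp
      from tendsto_divide[OF this tendsto_const[of "2 * (p\<^sup>2 - 1)"]] show ?thesis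
        using p2 by (simp add: F_def[abs_def])
    qed
  qed (use pos in \<open>auto intro!: divide_nonneg_nonneg mult_nonneg_nonneg\<close>)
  also have "0 - F 0 = ln p / (p\<^sup>2 - 1)"
    using p p2 by (simp add: F_def ln_realpow field_simps)
  finally show ?thesis .
qed

text \<open>The law of a product of two independent half-Cauchy variables, up to normalisation: substitute
  \<open>p = u * v\<close> in the inner integral, exchange the order of integration, and apply
  \<open>nn_integral_half_cauchy_convolution\<close> to the multiplicative convolution of the densities.\<close>
lemma nn_integral_product_half_cauchy:
  assumes [measurable]: "G \<in> borel_measurable borel"
  shows "(\<integral>\<^sup>+u. (\<integral>\<^sup>+v. G (u * v) * ennreal (1 / (1 + v\<^sup>2)) * indicator {0..} v \<partial>lborel) *
            ennreal (1 / (1 + u\<^sup>2)) * indicator {0..} u \<partial>lborel) =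
         (\<integral>\<^sup>+p. G p * ennreal (ln p / (p\<^sup>2 - 1)) * indicator {0..} p \<partial>lborel)"
proof -
  let ?k = "\<lambda>u p. ennreal (u / ((1 + u\<^sup>2) * (u\<^sup>2 + p\<^sup>2))) * indicator {0..} u"
  have scale: "(\<integral>\<^sup>+v. G (u * v) * ennreal (1 / (1 + v\<^sup>2)) * indicator {0..} v \<partial>lborel) * ennreal (1 / (1 + u\<^sup>2)) * indicator {0..} u
      = (\<integral>\<^sup>+p. G p * indicator {0..} p * ?k u p \<partial>lborel)" if "u \<noteq> 0" for u :: real
  proof (cases "u > 0")
    case u: True
    have "(\<integral>\<^sup>+v. G (u * v) * ennreal (1 / (1 + v\<^sup>2)) * indicator {0..} v \<partial>lborel) =
      ennreal (1 / u) * (\<integral>\<^sup>+p. G p * ennreal (1 / (1 + (p / u)\<^sup>2)) * indicator {0..} p \<partial>lborel)"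
      using u by (subst nn_integral_real_affine[of _ "1 / u" 0])
        (auto intro!: arg_cong2[of _ _ _ _ "(*)"] nn_integral_cong simp: indicator_def zero_le_divide_iff)
    also have "\<dots> * ennreal (1 / (1 + u\<^sup>2)) * indicator {0..} u = 
       ennreal (1 / u * (1 / (1 + u\<^sup>2))) * (\<integral>\<^sup>+p. G p * ennreal (1 / (1 + (p / u)\<^sup>2)) * indicator {0..} p \<partial>lborel)"
      using u by (subst ennreal_mult) (auto simp: mult_ac)
    also have "\<dots> = (\<integral>\<^sup>+p. ennreal (1 / u * (1 / (1 + u\<^sup>2))) * (G p * ennreal (1 / (1 + (p / u)\<^sup>2)) * indicator {0..} p) \<partial>lborel)"
      by (rule nn_integral_cmult[symmetric]) measurable
    also have "\<dots> = (\<integral>\<^sup>+p. G p * indicator {0..} p * ?k u p \<partial>lborel)"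
    proof (intro nn_integral_cong)
      fix p :: real
      have "u\<^sup>2 + p\<^sup>2 > 0" using u by (intro add_pos_nonneg) auto
      have sq: "1 + (p / u)\<^sup>2 = (u\<^sup>2 + p\<^sup>2) / u\<^sup>2"
        using u by (simp add: field_simps)
      have "1 / u * (1 / (1 + u\<^sup>2)) * (1 / (1 + (p / u)\<^sup>2)) = u / ((1 + u\<^sup>2) * (u\<^sup>2 + p\<^sup>2))"
        using u by (simp add: sq) (simp add: power2_eq_square)
      then have k: "ennreal (1 / u * (1 / (1 + u\<^sup>2))) * ennreal (1 / (1 + (p / u)\<^sup>2)) = ennreal (u / ((1 + u\<^sup>2) * (u\<^sup>2 + p\<^sup>2)))"
        using u by (subst ennreal_mult[symmetric]) auto
      have "ennreal (1 / u * (1 / (1 + u\<^sup>2))) * (G p * ennreal (1 / (1 + (p / u)\<^sup>2)) * indicator {0..} p)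
          = G p * indicator {0..} p * (ennreal (1 / u * (1 / (1 + u\<^sup>2))) * ennreal (1 / (1 + (p / u)\<^sup>2)))"
        by (simp only: mult_ac)
      then show "ennreal (1 / u * (1 / (1 + u\<^sup>2))) * (G p * ennreal (1 / (1 + (p / u)\<^sup>2)) * indicator {0..} p)
          = G p * indicator {0..} p * ?k u p"
        using u by (simp only: k) simp
    qed
    finally show ?thesis .
  qed (use that in auto)
  have "(\<integral>\<^sup>+u. (\<integral>\<^sup>+v. G (u * v) * ennreal (1 / (1 + v\<^sup>2)) * indicator {0..} v \<partial>lborel) *
            ennreal (1 / (1 + u\<^sup>2)) * indicator {0..} u \<partial>lborel) =
        (\<integral>\<^sup>+u. (\<integral>\<^sup>+p. G p * indicator {0..} p * ?k u p \<partial>lborel) \<partial>lborel)"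
    using AE_lborel_singleton[of "0 :: real"]
    by (intro nn_integral_cong_AE, elim eventually_mono) (use scale in auto)
  also have "\<dots> = (\<integral>\<^sup>+p. (\<integral>\<^sup>+u. G p * indicator {0..} p * ?k u p \<partial>lborel) \<partial>lborel)"
    by (rule lborel_pair.Fubini'[symmetric]) measurable
  also have "\<dots> = (\<integral>\<^sup>+p. G p * indicator {0..} p * (\<integral>\<^sup>+u. ?k u p \<partial>lborel) \<partial>lborel)"
    by (intro nn_integral_cong nn_integral_cmult) measurable
  also have "\<dots> = (\<integral>\<^sup>+p. G p * ennreal (ln p / (p\<^sup>2 - 1)) * indicator {0..} p \<partial>lborel)"
    using AE_lborel_singleton[of "0 :: real"] AE_lborel_singleton[of "1 :: real"]
  proof (intro nn_integral_cong_AE, eventually_elim)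
    case (elim p)
    then show ?case
      using nn_integral_half_cauchy_convolution[of p] by (auto simp: indicator_def)
  qed
  finally show ?thesis .
qed

section \<open>The value of the logarithmic integral\<close>

lemma nn_integral_ln_sq_over_power:
  fixes m :: nat
  assumes m: "m > 0"
  shows "(\<integral>\<^sup>+p. ennreal ((ln p)\<^sup>2 / p ^ Suc m) * indicator {1..} p \<partial>lborel) = ennreal (2 / real m ^ 3)"
proof -
  \<comment> \<open>The primitive obtained by integrating by parts twice.\<close>
  define F where "F p = - ((ln p)\<^sup>2 / m + 2 * ln p / real m ^ 2 + 2 / real m ^ 3) / p ^ m" for p :: real
  have "(\<integral>\<^sup>+p. ennreal ((ln p)\<^sup>2 / p ^ Suc m) * indicator {1..} p \<partial>lborel) = ennreal (0 - F 1)"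
  proof (rule nn_integral_FTC_atLeast)
    fix p :: real assume p: "p \<ge> 1"
    have "DERIV F p :> (- (2 * ln p / (m * p) + 2 / (real m ^ 2 * p)) * p ^ m +
             ((ln p)\<^sup>2 / m + 2 * ln p / real m ^ 2 + 2 / real m ^ 3) * (m * p ^ (m - 1))) / (p ^ m * p ^ m)"
      unfolding F_def using p m by (auto intro!: derivative_eq_intros simp: field_simps)
    also have "(- (2 * ln p / (m * p) + 2 / (real m ^ 2 * p)) * p ^ m +
             ((ln p)\<^sup>2 / m + 2 * ln p / real m ^ 2 + 2 / real m ^ 3) * (m * p ^ (m - 1))) / (p ^ m * p ^ m)
         = (ln p)\<^sup>2 / p ^ Suc m"
    proof -
      define L q where "L = ln p" and "q = p ^ (m - 1)"
      have q: "p ^ m = p * q" "q > 0"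
        using m p by (cases m; simp add: q_def)+
      have "(2 * L / (m * p) + 2 / (real m ^ 2 * p)) * (p * q) = (2 * L / m + 2 / real m ^ 2) * q"
        using p m by (simp add: field_simps)
      moreover have "(L\<^sup>2 / m + 2 * L / real m ^ 2 + 2 / real m ^ 3) * (m * q) = (L\<^sup>2 + 2 * L / m + 2 / real m ^ 2) * q"
        using m by (simp add: field_simps power2_eq_square power3_eq_cube)
      ultimately have "- (2 * L / (m * p) + 2 / (real m ^ 2 * p)) * (p * q) +
             (L\<^sup>2 / m + 2 * L / real m ^ 2 + 2 / real m ^ 3) * (m * q) = L\<^sup>2 * q"
        by (simp add: algebra_simps)
      then show ?thesis
        using p q(2) unfolding q(1) L_def[symmetric] q_def[symmetric] power_Suc by simp
    qed
    finally show "DERIV F p :> (ln p)\<^sup>2 / p ^ Suc m" .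
  next
    have "((\<lambda>p. - ((ln p)\<^sup>2 / m + 2 * ln p / real m ^ 2 + 2 / real m ^ 3) / p powr m) \<longlongrightarrow> 0) at_top"
      using m by real_asymp
    then show "(F \<longlongrightarrow> 0) at_top"
    proof (rule Lim_transform_eventually)
      show "eventually (\<lambda>p. - ((ln p)\<^sup>2 / m + 2 * ln p / real m ^ 2 + 2 / real m ^ 3) / p powr m = F p) at_top"
        using eventually_gt_at_top[of 0] by eventually_elim (simp add: F_def powr_realpow)
    qed
  qed auto
  also have "0 - F 1 = 2 / real m ^ 3" by (simp add: F_def)
  finally show ?thesis .
qed

text \<open>The terms with an even denominator contribute \<open>Z / 8\<close> to the sum.\<close>
lemma odd_cubes_sums:
  assumes "(\<lambda>n. 1 / real (Suc n) ^ 3) sums Z"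
  shows "(\<lambda>k. 1 / real (2 * k + 1) ^ 3) sums (7 / 8 * Z)"
proof -
  have "(\<lambda>k. \<Sum>n\<in>{k * 2..<k * 2 + 2}. 1 / real (Suc n) ^ 3) sums Z"
    by (rule sums_group[OF assms]) auto
  moreover have "(\<Sum>n\<in>{k * 2..<k * 2 + 2}. 1 / real (Suc n) ^ 3) = 
      1 / real (2 * k + 1) ^ 3 + 1 / 8 * (1 / real (Suc k) ^ 3)" for k
  proof -
    have "{k * 2..<k * 2 + 2} = {2 * k, 2 * k + 1}" by auto
    moreover have "real (Suc (2 * k + 1)) = 2 * real (Suc k)" by simp
    ultimately show ?thesis by (simp add: power_mult_distrib del: of_nat_Suc of_nat_add)
  qed
  ultimately have "(\<lambda>k. 1 / real (2 * k + 1) ^ 3 + 1 / 8 * (1 / real (Suc k) ^ 3)) sums Z" by simp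
  from sums_diff[OF this sums_mult[OF assms, of "1 / 8"]] show ?thesis
    by (simp add: algebra_simps)
qed

lemma zeta_3_sums:
  obtains Z where "(\<lambda>n. 1 / real (Suc n) ^ 3) sums Z" "riemann_zeta 3 = of_real Z"
proof
  have "summable (\<lambda>n. 1 / real n ^ 3)"
    using inverse_power_summable[of 3, where 'a = real] by (simp add: field_simps)
  then have "summable (\<lambda>n. 1 / real (Suc n) ^ 3)" by (subst summable_Suc_iff)
  then show sums: "(\<lambda>n. 1 / real (Suc n) ^ 3) sums (suminf (\<lambda>n. 1 / real (Suc n) ^ 3))"
    by (rule summable_sums)
  have "(\<lambda>n. 1 / of_nat (Suc n) powr (3 :: complex)) = (\<lambda>n. of_real (1 / real (Suc n) ^ 3))"
  proof
    fix n
    have "of_nat (Suc n) powr (3 :: complex) = (of_nat (Suc n) :: complex) ^ 3"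
      using powr_nat[of "of_nat (Suc n) :: complex" 3] by (simp del: of_nat_Suc)
    then show "1 / of_nat (Suc n) powr (3 :: complex) = of_real (1 / real (Suc n) ^ 3)" 
      by (simp del: of_nat_Suc)
  qed
  then show "riemann_zeta 3 = of_real (suminf (\<lambda>n. 1 / real (Suc n) ^ 3))"
    unfolding riemann_zeta_def using sums_of_real[OF sums, where 'a = complex] by (simp add: sums_iff)
qed

text \<open>The factor \<open>ennreal (ln p)\<close> is the positive part of the logarithm, so only \<open>p > 1\<close>
  contributes; there \<open>1 / (p\<^sup>2 - 1)\<close> is the geometric series \<open>\<Sum>k. 1 / p ^ (2 * k + 2)\<close>, which is
  integrated termwise.\<close>
lemma nn_integral_ln_sq:
  assumes "(\<lambda>n. 1 / real (Suc n) ^ 3) sums Z"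
  shows "(\<integral>\<^sup>+p. ennreal (ln p) * ennreal (ln p / (p\<^sup>2 - 1)) * indicator {0..} p \<partial>lborel) = ennreal (7 / 4 * Z)"
proof -
  have "(\<integral>\<^sup>+p. ennreal (ln p) * ennreal (ln p / (p\<^sup>2 - 1)) * indicator {0..} p \<partial>lborel) =
        (\<integral>\<^sup>+p. (suminf (\<lambda>k. ennreal ((ln p)\<^sup>2 / p ^ Suc (2 * k + 1)) * indicator {1..} p)) \<partial>lborel)"
    using AE_lborel_singleton[of "1 :: real"]
  proof (intro nn_integral_cong_AE, eventually_elim)
    case (elim p)
    show ?case
    proof (cases "p > 1")
      case True
      have p2: "p\<^sup>2 > 1" using True by (simp add: one_less_power)
      have "(\<lambda>k. (1 / p\<^sup>2) ^ k) sums (1 / (1 - 1 / p\<^sup>2))"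
        using p2 True by (intro geometric_sums) (auto simp: divide_less_eq)
      from sums_mult[OF this, of "(ln p)\<^sup>2 / p\<^sup>2"]
      have "(\<lambda>k. (ln p)\<^sup>2 / p\<^sup>2 * (1 / p\<^sup>2) ^ k) sums ((ln p)\<^sup>2 / p\<^sup>2 * (1 / (1 - 1 / p\<^sup>2)))" .
      also have "(\<lambda>k. (ln p)\<^sup>2 / p\<^sup>2 * (1 / p\<^sup>2) ^ k) = (\<lambda>k. (ln p)\<^sup>2 / p ^ Suc (2 * k + 1))"
        by (rule ext) (simp add: power_one_over power_mult power2_eq_square field_simps)
      also have "(ln p)\<^sup>2 / p\<^sup>2 * (1 / (1 - 1 / p\<^sup>2)) = ln p * (ln p / (p\<^sup>2 - 1))"
        using True p2 by (simp add: field_simps power2_eq_square)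
      finally have "(\<lambda>k. (ln p)\<^sup>2 / p ^ Suc (2 * k + 1)) sums (ln p * (ln p / (p\<^sup>2 - 1)))" .
      then have sum_eq: "(suminf (\<lambda>k. ennreal ((ln p)\<^sup>2 / p ^ Suc (2 * k + 1)))) = ennreal (ln p * (ln p / (p\<^sup>2 - 1)))"
        using True by (intro suminf_ennreal_eq) auto
      have ind: "indicator {0..} p = (1 :: ennreal)" "indicator {1..} p = (1 :: ennreal)"
        using True by auto
      show ?thesis unfolding ind mult_1_right sum_eq
        by (rule ennreal_mult[symmetric]) (use True p2 in auto)
    next
      case False
      then have "ennreal (ln p) * indicator {0..} p = 0"
        by (cases "p = 0") (auto simp: indicator_def ennreal_neg)
      then have "ennreal (ln p) * ennreal (ln p / (p\<^sup>2 - 1)) * indicator {0..} p = 0"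
        by (auto)
      then show ?thesis using False elim by simp
    qed
  qed
  also have "\<dots> = (suminf (\<lambda>k. \<integral>\<^sup>+p. ennreal ((ln p)\<^sup>2 / p ^ Suc (2 * k + 1)) * indicator {1..} p \<partial>lborel))"
    by (rule nn_integral_suminf) measurable
  also have "\<dots> = (suminf (\<lambda>k. ennreal (2 / real (2 * k + 1) ^ 3)))"
    by (intro suminf_cong nn_integral_ln_sq_over_power) auto
  also have "\<dots> = ennreal (7 / 4 * Z)"
  proof (rule suminf_ennreal_eq)
    show "(\<lambda>k. 2 / real (2 * k + 1) ^ 3) sums (7 / 4 * Z)"
      using sums_mult[OF odd_cubes_sums[OF assms], of 2] by simp
  qed auto
  finally show ?thesis .
qed

text \<open>The integrand is the positive part of the logarithm, because \<open>ennreal\<close> maps negative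
  numbers to 0. Each tangent contributes a factor \<open>2 / pi\<close>.\<close>
lemma nn_integral_ln_tan_tan:
  assumes "(\<lambda>n. 1 / real (Suc n) ^ 3) sums Z"
  shows "(\<integral>\<^sup>+s. (\<integral>\<^sup>+t. ennreal (ln (\<bar>tan (pi * s)\<bar> * \<bar>tan (pi * t)\<bar>)) * indicator {0..1} t \<partial>lborel) *
            indicator {0..1} s \<partial>lborel) = ennreal (7 * Z / pi\<^sup>2)"
proof -
  let ?c = "ennreal (2 / pi)"
  let ?w = "\<lambda>u::real. ennreal (1 / (1 + u\<^sup>2))"
  have "(\<integral>\<^sup>+s. (\<integral>\<^sup>+t. ennreal (ln (\<bar>tan (pi * s)\<bar> * \<bar>tan (pi * t)\<bar>)) * indicator {0..1} t \<partial>lborel) *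
            indicator {0..1} s \<partial>lborel) =
     (\<integral>\<^sup>+s. (?c * (\<integral>\<^sup>+v. ennreal (ln (\<bar>tan (pi * s)\<bar> * v)) * ?w v * indicator {0..} v \<partial>lborel)) *
            indicator {0..1} s \<partial>lborel)"
    by (subst nn_integral_abs_tan) auto
  also have "\<dots> = ?c * (\<integral>\<^sup>+u. (?c * (\<integral>\<^sup>+v. ennreal (ln (u * v)) * ?w v * indicator {0..} v \<partial>lborel)) *
       ?w u * indicator {0..} u \<partial>lborel)"
    by (subst nn_integral_abs_tan) auto
  also have "\<dots> = ?c * (?c * (\<integral>\<^sup>+u. (\<integral>\<^sup>+v. ennreal (ln (u * v)) * ?w v * indicator {0..} v \<partial>lborel) *
       ?w u * indicator {0..} u \<partial>lborel))"
    by (subst nn_integral_cmult[symmetric]) (auto simp: mult_ac)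
  also have "\<dots> = ?c * (?c * ennreal (7 / 4 * Z))"
    by (subst nn_integral_product_half_cauchy) (auto simp: nn_integral_ln_sq[OF assms])
  also have "\<dots> = ennreal (7 * Z / pi\<^sup>2)"
  proof -
    have "Z \<ge> 0" using sums_le[OF _ sums_zero assms] by simp
    then show ?thesis by (simp add: power2_eq_square flip: ennreal_mult)
  qed
  finally show ?thesis .
qed

section \<open>The Mahler measure\<close>

lemma nn_integral_PiM_lessThan_3:
  fixes f :: "(nat \<Rightarrow> real) \<Rightarrow> ennreal"
  assumes f: "f \<in> borel_measurable (\<Pi>\<^sub>M j\<in>{..<3}. lborel)"
  shows "(\<integral>\<^sup>+x. f x \<partial>(\<Pi>\<^sub>M j\<in>{..<3}. lborel)) =
         (\<integral>\<^sup>+s. \<integral>\<^sup>+t. \<integral>\<^sup>+r. f ((\<lambda>_. undefined)(0 := s, 1 := t, 2 := r)) \<partial>lborel \<partial>lborel \<partial>lborel)"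
proof -
  interpret product_sigma_finite "\<lambda>_::nat. lborel :: real measure" ..
  have I3: "{..<3::nat} = insert 2 (insert 1 (insert 0 {}))" by auto
  have f [measurable]: "f \<in> borel_measurable (\<Pi>\<^sub>M j\<in>insert 2 (insert 1 (insert 0 {})). lborel)"
    using f unfolding I3 .
  have "(\<integral>\<^sup>+x. f x \<partial>(\<Pi>\<^sub>M j\<in>{..<3}. lborel)) =
      (\<integral>\<^sup>+x. \<integral>\<^sup>+r. f (x(2 := r)) \<partial>lborel \<partial>(\<Pi>\<^sub>M j\<in>insert 1 (insert 0 {}). lborel))"
    unfolding I3 by (rule product_nn_integral_insert[OF _ _ f]) auto
  also have "\<dots> = (\<integral>\<^sup>+x. \<integral>\<^sup>+t. \<integral>\<^sup>+r. f (x(1 := t, 2 := r)) \<partial>lborel \<partial>lborel \<partial>(\<Pi>\<^sub>M j\<in>insert 0 {}. lborel))"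
    by (rule product_nn_integral_insert, simp, simp, measurable)
  also have "\<dots> = (\<integral>\<^sup>+x. \<integral>\<^sup>+s. \<integral>\<^sup>+t. \<integral>\<^sup>+r. f (x(0 := s, 1 := t, 2 := r)) \<partial>lborel \<partial>lborel \<partial>lborel \<partial>(\<Pi>\<^sub>M j\<in>{}. lborel))"
    by (rule product_nn_integral_insert, simp, simp, measurable)
  also have "\<dots> = (\<integral>\<^sup>+s. \<integral>\<^sup>+t. \<integral>\<^sup>+r. f ((\<lambda>_. undefined)(0 := s, 1 := t, 2 := r)) \<partial>lborel \<partial>lborel \<partial>lborel)"
    by (rule nn_integral_empty) simp
  finally show ?thesis .
qed

lemma nn_integral_jensen_linear:
  assumes "a \<noteq> 0 \<or> b \<noteq> 0" "norm a + norm b \<le> M" "M \<ge> 1"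
  shows "(\<integral>\<^sup>+r. ennreal (ln M - ln (norm (a + b * cis (2 * pi * r)))) * indicator {0..1} r \<partial>lborel) =
         ennreal (ln M - ln (max (norm a) (norm b)))"
proof -
  let ?f = "\<lambda>r. indicator {0..1} r * ln M - indicator {0..1} r * ln (norm (a + b * cis (2 * pi * r)))"
  have le: "ln (norm (a + b * cis s)) \<le> ln M" for s
  proof (cases "a + b * cis s = 0")
    case False
    have "norm (a + b * cis s) \<le> M"
      using norm_triangle_ineq[of a "b * cis s"] assms(2) by (simp add: norm_mult)
    then show ?thesis using False assms(3) by (subst ln_le_cancel_iff) auto
  qed (use assms in auto)
  have "has_bochner_integral lborel ?f (ln M - ln (max (norm a) (norm b)))"
    by (intro has_bochner_integral_diff jensen_linear assms) (auto simp: has_bochner_integral_iff)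
  then have "(\<integral>\<^sup>+r. ennreal (?f r) \<partial>lborel) = ennreal (ln M - ln (max (norm a) (norm b)))"
    using le by (subst nn_integral_eq_integral) (auto simp: has_bochner_integral_iff indicator_def)
  also have "(\<integral>\<^sup>+r. ennreal (?f r) \<partial>lborel) = 
     (\<integral>\<^sup>+r. ennreal (ln M - ln (norm (a + b * cis (2 * pi * r)))) * indicator {0..1} r \<partial>lborel)"
    by (intro nn_integral_cong) (auto simp: indicator_def)
  finally show ?thesis .
qed

text \<open>Factor \<open>cis \<theta>\<close> out of \<open>1 + cis (2 * \<theta>)\<close> and \<open>1 - cis (2 * \<theta>)\<close>.\<close>
lemma abs_tan_conv_cis: "\<bar>tan \<theta>\<bar> = norm (1 - cis (2 * \<theta>)) / norm (1 + cis (2 * \<theta>))"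
proof -
  have "1 + cis (2 * \<theta>) = of_real (2 * cos \<theta>) * cis \<theta>"
    by (simp add: complex_eq_iff cos_double_cos sin_double power2_eq_square)
  moreover have "1 - cis (2 * \<theta>) = of_real (2 * sin \<theta>) * (- \<i> * cis \<theta>)"
    by (simp add: complex_eq_iff cos_double_sin sin_double power2_eq_square)
  ultimately show ?thesis 
    by (simp only: norm_mult norm_of_real) (simp add: tan_def abs_mult)
qed

text \<open>In \<open>ennreal\<close> the second summand is the positive part of \<open>ln (y / x)\<close>, the difference between
  \<open>ln (max x y)\<close> and \<open>ln x\<close>. In this arrangement every term is nonnegative, and no subtraction of
  possibly infinite integrals occurs.\<close>
lemma ennreal_ln_max_split:
  assumes "0 < x" "0 \<le> y" "max x y \<le> M"
  shows "ennreal (ln M - ln (max x y)) + ennreal (ln (y / x)) = ennreal (ln M - ln x)"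
proof (cases "y \<le> x")
  case True
  then have "ln (y / x) \<le> 0"
    using assms by (cases "y = 0") auto
  then show ?thesis using True by (simp add: ennreal_neg max_def)
next
  case False
  then show ?thesis using assms by (subst ennreal_plus[symmetric]) (auto simp: ln_div max_def)
qed

lemma norm_one_plus_minus_le:
  fixes u :: complex
  assumes "norm u = 1"
  shows "norm (1 + u) \<le> 2" "norm (1 - u) \<le> 2"
  using norm_triangle_ineq[of 1 u] norm_triangle_ineq4[of 1 u] assms by auto

lemma norm_coeff_le:
  fixes w x :: complex
  assumes "norm w = 1" "norm x = 1"
  shows "norm ((1 + w) * (1 + x)) \<le> 4" "norm ((1 - w) * (1 - x)) \<le> 4"
  using mult_mono[OF norm_one_plus_minus_le(1) norm_one_plus_minus_le(1)]
    mult_mono[OF norm_one_plus_minus_le(2) norm_one_plus_minus_le(2)] assms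
  by (auto simp: norm_mult)

lemma ln_8: "ln (8 :: real) = ln 2 + ln 2 + ln 2"
  using ln_realpow[of 2 3] by simp

lemma ln_norm_le:
  fixes w x y :: complex
  assumes "norm w = 1" "norm x = 1" "norm y = 1"
  shows "ln (norm ((1 + w) * (1 + x) + (1 - w) * (1 - x) * y)) \<le> ln 8"
proof (cases "(1 + w) * (1 + x) + (1 - w) * (1 - x) * y = 0")
  case False
  have "norm ((1 + w) * (1 + x) + (1 - w) * (1 - x) * y) \<le> norm ((1 + w) * (1 + x)) + norm ((1 - w) * (1 - x) * y)"
    by (rule norm_triangle_ineq)
  also have "\<dots> \<le> 4 + 4"
    using norm_coeff_le[OF assms(1,2)] assms(3) by (intro add_mono) (simp_all add: norm_mult)
  finally show ?thesis using False by (subst ln_le_cancel_iff) auto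
qed auto

text \<open>Jensen's formula in \<open>y\<close> for fixed \<open>w\<close> and \<open>x\<close>: the term that involves both \<open>w\<close> and \<open>x\<close>
  is separated from terms in one variable each. The constant \<open>ln 8\<close> bounds the logarithm of the polynomial and is distributed
  as \<open>ln 2\<close> over the three terms on the right.\<close>
lemma mahler_fibre_identity:
  assumes "1 + w \<noteq> 0" "1 + x \<noteq> 0" "norm w = 1" "norm x = 1"
  shows "(\<integral>\<^sup>+r. ennreal (ln 8 - ln (norm ((1 + w) * (1 + x) + (1 - w) * (1 - x) * cis (2 * pi * r)))) * indicator {0..1} r \<partial>lborel)
        + ennreal (ln (norm (1 - w) / norm (1 + w) * (norm (1 - x) / norm (1 + x)))) =
     ennreal (ln 2 - ln (norm (1 + w))) + ennreal (ln 2 - ln (norm (1 + x))) + ennreal (ln 2)"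
proof -
  note le2 = norm_one_plus_minus_le and le4 = norm_coeff_le[OF assms(3,4)]
  have "(\<integral>\<^sup>+r. ennreal (ln 8 - ln (norm ((1 + w) * (1 + x) + (1 - w) * (1 - x) * cis (2 * pi * r)))) * indicator {0..1} r \<partial>lborel)
        = ennreal (ln 8 - ln (max (norm ((1 + w) * (1 + x))) (norm ((1 - w) * (1 - x)))))"
    using assms le4 by (intro nn_integral_jensen_linear) (auto simp: norm_mult)
  also have "\<dots> + ennreal (ln (norm (1 - w) / norm (1 + w) * (norm (1 - x) / norm (1 + x)))) =
       ennreal (ln 8 - ln (norm ((1 + w) * (1 + x))))"
    using assms le4 ennreal_ln_max_split[of "norm ((1 + w) * (1 + x))" "norm ((1 - w) * (1 - x))" 8]
    by (simp add: norm_mult)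
  also have "ln 8 - ln (norm ((1 + w) * (1 + x))) = 
      (ln 2 - ln (norm (1 + w))) + (ln 2 - ln (norm (1 + x))) + ln 2"
    using assms by (simp add: ln_8 norm_mult ln_mult)
  also have "ennreal \<dots> = ennreal (ln 2 - ln (norm (1 + w))) + ennreal (ln 2 - ln (norm (1 + x))) + ennreal (ln 2)"
  proof -
    have "0 \<le> ln 2 - ln (norm (1 + w))" "0 \<le> ln 2 - ln (norm (1 + x))" "0 \<le> ln (2 :: real)"
      using assms le2 by auto
    then show ?thesis by (simp only: ennreal_plus add_nonneg_nonneg)
  qed
  finally show ?thesis .
qed

text \<open>Integrate \<open>mahler_fibre_identity\<close> over \<open>w\<close> and \<open>x\<close>. The terms in \<open>w\<close> alone and in \<open>x\<close> alone
  contribute \<open>ln 2\<close> each, since \<open>ln (norm (1 + w))\<close> has mean 0.\<close>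
lemma nn_integral_log_polynomial:
  assumes "(\<lambda>n. 1 / real (Suc n) ^ 3) sums Z"
  shows "(\<integral>\<^sup>+s. (\<integral>\<^sup>+t. (\<integral>\<^sup>+r. ennreal (ln 8 - ln (norm ((1 + cis (2 * pi * s)) * (1 + cis (2 * pi * t)) + 
               (1 - cis (2 * pi * s)) * (1 - cis (2 * pi * t)) * cis (2 * pi * r)))) * indicator {0..1} r \<partial>lborel) *
               indicator {0..1} t \<partial>lborel) * indicator {0..1} s \<partial>lborel)
         + ennreal (7 * Z / pi\<^sup>2) = ennreal (ln 8)"
    (is "(\<integral>\<^sup>+s. (\<integral>\<^sup>+t. ?X s t * indicator {0..1} t \<partial>lborel) * indicator {0..1} s \<partial>lborel) + _ = _")
proof -
  define c where "c s = ennreal (ln 2 - ln (norm (1 + cis (2 * pi * s))))" for s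
  have [measurable]: "c \<in> borel_measurable borel" unfolding c_def by measurable
  let ?T = "\<lambda>s t. ennreal (ln (\<bar>tan (pi * s)\<bar> * \<bar>tan (pi * t)\<bar>))"
  have c: "(\<integral>\<^sup>+s. c s * indicator {0..1} s \<partial>lborel) = ennreal (ln 2)"
    using nn_integral_jensen_linear[of 1 1 2] by (simp add: c_def)
  have inner: "(\<integral>\<^sup>+t. ?X s t * indicator {0..1} t \<partial>lborel) + (\<integral>\<^sup>+t. ?T s t * indicator {0..1} t \<partial>lborel)
       = c s + ennreal (ln 2) + ennreal (ln 2)" if "cis (2 * pi * s) \<noteq> -1" for s
  proof -
    have "(\<integral>\<^sup>+t. ?X s t * indicator {0..1} t \<partial>lborel) + (\<integral>\<^sup>+t. ?T s t * indicator {0..1} t \<partial>lborel)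
       = (\<integral>\<^sup>+t. ?X s t * indicator {0..1} t + ?T s t * indicator {0..1} t \<partial>lborel)"
      by (rule nn_integral_add[symmetric]) measurable
    also have "\<dots> = (\<integral>\<^sup>+t. (c s + ennreal (ln 2)) * indicator {0..1} t + c t * indicator {0..1} t \<partial>lborel)"
      using AE_cis_neq[of "-1"]
    proof (intro nn_integral_cong_AE, eventually_elim)
      case (elim t)
      have "1 + cis (2 * pi * u) \<noteq> 0" if "cis (2 * pi * u) \<noteq> -1" for u
        using that by (simp add: add_eq_0_iff)
      then have "?X s t + ?T s t = c s + c t + ennreal (ln 2)"
        using mahler_fibre_identity[of "cis (2 * pi * s)" "cis (2 * pi * t)"] elim that
        by (simp add: abs_tan_conv_cis c_def mult.assoc)
      then show ?case by (auto simp: indicator_def algebra_simps)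
    qed
    also have "\<dots> = c s + ennreal (ln 2) + ennreal (ln 2)"
      by (subst nn_integral_add) (auto simp: c nn_integral_cmult_indicator)
    finally show ?thesis .
  qed
  have "(\<integral>\<^sup>+s. (\<integral>\<^sup>+t. ?X s t * indicator {0..1} t \<partial>lborel) * indicator {0..1} s \<partial>lborel)
         + ennreal (7 * Z / pi\<^sup>2) =
        (\<integral>\<^sup>+s. (\<integral>\<^sup>+t. ?X s t * indicator {0..1} t \<partial>lborel) * indicator {0..1} s + 
              (\<integral>\<^sup>+t. ?T s t * indicator {0..1} t \<partial>lborel) * indicator {0..1} s \<partial>lborel)"
    unfolding nn_integral_ln_tan_tan[OF assms, symmetric]
    by (rule nn_integral_add[symmetric]) measurable
  also have "\<dots> = (\<integral>\<^sup>+s. (ennreal (ln 2) + ennreal (ln 2)) * indicator {0..1} s + c s * indicator {0..1} s \<partial>lborel)"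
    using AE_cis_neq[of "-1"]
  proof (intro nn_integral_cong_AE, eventually_elim)
    case (elim s)
    show ?case using inner[OF elim(2)] by (auto simp: indicator_def algebra_simps)
  qed
  also have "\<dots> = ennreal (ln 2) + ennreal (ln 2) + ennreal (ln 2)"
    by (subst nn_integral_add) (auto simp: c nn_integral_cmult_indicator)
  also have "\<dots> = ennreal (ln 8)"
    by (simp add: ln_8 flip: ennreal_plus)
  finally show ?thesis .
qed

theorem mainTheorem8:
  shows "let w = mvar 0; x = mvar 1; y = mvar 2 in
    of_real pi ^ 2 * mahler_measure 3 ((1 + w) * (1 + x) + (1 - w) * (1 - x) * y)
      = 7 * riemann_zeta 3"
proof -
  let ?P = "(1 + mvar 0) * (1 + mvar 1) + (1 - mvar 0) * (1 - mvar 1) * mvar 2 :: complex mpoly"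
  let ?M = "\<Pi>\<^sub>M j\<in>{..<3::nat}. (lborel :: real measure)"
  let ?B = "{..<3::nat} \<rightarrow>\<^sub>E {0..1 :: real}"
  interpret product_sigma_finite "\<lambda>_::nat. lborel :: real measure" ..
  obtain Z where Z: "(\<lambda>n. 1 / real (Suc n) ^ 3) sums Z" "riemann_zeta 3 = of_real Z"
    by (rule zeta_3_sums)
  have Z_nonneg: "Z \<ge> 0" using sums_le[OF _ sums_zero Z(1)] by simp
  define K where "K = 7 * Z / pi\<^sup>2"
  have K: "K \<ge> 0" using Z_nonneg by (simp add: K_def)
  define L where "L t = ln (norm ((1 + cis (2 * pi * t 0)) * (1 + cis (2 * pi * t 1)) + 
     (1 - cis (2 * pi * t 0)) * (1 - cis (2 * pi * t 1)) * cis (2 * pi * t 2)))" for t :: "nat \<Rightarrow> real"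
  have cis_comp: "(\<lambda>t. cis (2 * pi * t i)) \<in> borel_measurable ?M" if "i < 3" for i
    using measurable_component_singleton[of i "{..<3}" "\<lambda>_. lborel"] that
    by (intro measurable_compose[OF _ borel_measurable_cis] borel_measurable_times borel_measurable_const) simp
  have [measurable]: "L \<in> borel_measurable ?M" unfolding L_def
    by (intro borel_measurable_ln borel_measurable_norm borel_measurable_add borel_measurable_diff
        borel_measurable_times borel_measurable_const cis_comp) auto
  have box [measurable]: "?B \<in> sets ?M" by (intro sets_PiM_I_finite) auto
  have L_le: "L t \<le> ln 8" for t
    unfolding L_def by (intro ln_norm_le) auto
  let ?g = "\<lambda>t. indicator ?B t * (ln 8 - L t)"
  \<comment> \<open>Finiteness of this integral is what makes \<open>L\<close> integrable on the box.\<close>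
  have "(\<integral>\<^sup>+t. ennreal (?g t) \<partial>?M) + ennreal K = ennreal (ln 8)"
  proof -
    have "(\<integral>\<^sup>+t. ennreal (?g t) \<partial>?M) = (\<integral>\<^sup>+s. \<integral>\<^sup>+t. \<integral>\<^sup>+r. ennreal (?g ((\<lambda>_. undefined)(0 := s, 1 := t, 2 := r))) \<partial>lborel \<partial>lborel \<partial>lborel)"
      by (rule nn_integral_PiM_lessThan_3) measurable
    also have "\<dots> = (\<integral>\<^sup>+s. (\<integral>\<^sup>+t. (\<integral>\<^sup>+r. ennreal (ln 8 - ln (norm ((1 + cis (2 * pi * s)) * (1 + cis (2 * pi * t)) + 
               (1 - cis (2 * pi * s)) * (1 - cis (2 * pi * t)) * cis (2 * pi * r)))) * indicator {0..1} r \<partial>lborel) *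
               indicator {0..1} t \<partial>lborel) * indicator {0..1} s \<partial>lborel)"
    proof -
      have ind: "indicator ?B ((\<lambda>_. undefined)(0 := s, 1 := t, 2 := r)) = 
         (indicator {0..1} r * indicator {0..1} t * indicator {0..1} s :: real)" for s t r :: real
      proof -
        have "{..<3::nat} = {0, 1, 2}" by auto
        then show ?thesis by (auto simp: indicator_def PiE_iff extensional_def)
      qed
      define F where "F s t r = ln (norm ((1 + cis (2 * pi * s)) * (1 + cis (2 * pi * t)) + 
               (1 - cis (2 * pi * s)) * (1 - cis (2 * pi * t)) * cis (2 * pi * r)))" for s t r
      have LF: "L ((\<lambda>_. undefined)(0 := s, 1 := t, 2 := r)) = F s t r" for s t r
        by (simp add: L_def F_def)
      have r_int: "(\<integral>\<^sup>+r. ennreal (indicator {0..1} r * indicator {0..1} t * indicator {0..1} s * (ln 8 - F s t r)) \<partial>lborel) =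
          (\<integral>\<^sup>+r. ennreal (ln 8 - F s t r) * indicator {0..1} r \<partial>lborel) * indicator {0..1} t * indicator {0..1} s" for s t
        by (cases "s \<in> {0..1} \<and> t \<in> {0..1}") (auto simp: indicator_def intro!: nn_integral_cong)
      have t_int: "(\<integral>\<^sup>+t. X t * indicator {0..1} s \<partial>lborel) = (\<integral>\<^sup>+t. X t \<partial>lborel) * indicator {0..1} s"
        for X :: "real \<Rightarrow> ennreal" and s :: real
        by (cases "s \<in> {0..1}") auto
      show ?thesis unfolding ind LF r_int t_int unfolding F_def ..
    qed
    finally show ?thesis using nn_integral_log_polynomial[OF Z(1)] by (simp add: K_def)
  qed
  moreover from this obtain x where x: "x \<ge> 0" "(\<integral>\<^sup>+t. ennreal (?g t) \<partial>?M) = ennreal x"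
    by (cases "\<integral>\<^sup>+t. ennreal (?g t) \<partial>?M") auto
  ultimately have "x = ln 8 - K" using K by (simp flip: ennreal_plus)
  with x have g: "has_bochner_integral ?M ?g (ln 8 - K)"
    using L_le by (intro has_bochner_integral_nn_integral) auto
  have "emeasure ?M ?B = 1" by (subst emeasure_PiM) auto
  then have "has_bochner_integral ?M (\<lambda>t. indicator ?B t * ln 8 :: real) (1 * ln 8)"
    using has_bochner_integral_real_indicator[OF box] 
    by (intro has_bochner_integral_mult_left) (simp add: measure_def)
  from has_bochner_integral_diff[OF this g]
  have "has_bochner_integral ?M (\<lambda>t. indicator ?B t *\<^sub>R L t) K" by (simp add: algebra_simps)
  then have int: "(LINT t:?B|?M. L t) = K"
    unfolding set_lebesgue_integral_def by (rule has_bochner_integral_integral_eq)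
  have exp_cis: "exp (2 * of_real pi * \<i> * of_real u) = cis (2 * pi * u)" for u
    by (simp add: cis_conv_exp mult_ac)
  have "mahler_measure 3 ?P = of_real K"
    unfolding mahler_measure_eq int[symmetric] L_def by (simp add: exp_cis)
  then show ?thesis unfolding Let_def by (simp add: K_def Z(2))
qed

end
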